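(* Let $c=(c_1,\dots,c_N)\in\mathbb{R}^N$ be a given constant vector and let $l>0$. Let $u_j(x,t)$, $j=1,2,\dots,N$, be the vanishing viscosity solution of $$(u_j)_t+\sigma(c,u)(u_j)_x=0,\qquad u_j(x,0)=u_{0j}(x),\qquad j=1,2,\dots,N,$$ where $u=(u_1,\dots,u_N)$ and $\sigma(c,u)=\sum_{k=1}^N c_ku_k$, with initial data $u_0=(u_{01},\dots,u_{0N})$ supported in $[-l,l]$. Let $x=s_j^-(t)$ and $x=s_j^+(t)$ be the left and right boundary curves of the support of $u_j(x,t)$. Then there exists a constant $A>0$, which depends on $l$ and $\|u_0\|_\infty$, so that the following estimate holds for $t\gg1$: $$-l-A\,t^{1/2}\le s_j^-(t)\le s_j^+(t)\le l+A\,t^{1/2}.$$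
   Context: Vanishing viscosity solution: the limit $u_j(x,t)=\lim_{\nu\to0}u_j^\nu(x,t)$, $j=1,\dots,N$, where for $\nu>0$ $$u_j^\nu(x,t)=\frac{\int_{-\infty}^{\infty}u_{0j}(y)\,e^{-\frac1\nu\left[I(y)+\frac{(x-y)^2}{2t}\right]}\,dy}{\int_{-\infty}^{\infty}e^{-\frac1\nu\left[I(y)+\frac{(x-y)^2}{2t}\right]}\,dy},\qquad I(y)=\int_0^y\sum_{k=1}^N c_ku_{0k}(z)\,dz,$$ is the solution of $(u_j)_t+\sigma(c,u)(u_j)_x=\frac{\nu}{2}(u_j)_{xx}$ with $u_j(x,0)=u_{0j}(x)$. (It is known, for instance, that when the $u_{0j}$ are Lipschitz continuous this limit exists for each $t>0$ except for countably many $x$, and equals $u_{0j}(y(x,t))$, where $y(x,t)$ is a minimizer of $\min_{-\infty<y<\infty}\left(I(y)+\frac{(x-y)^2}{2t}\right)$.) For a function $a(x,t)$ on $\{(x,t):-\infty<x<\infty,\ t>0\}$, the left boundary curve $x=s^-(t)$ and the right boundary curve $x=s^+(t)$ of the support of $a(x,t)$ are defined by $s^-(t)=\sup\{y: a(x,t)=0\text{ for all }x<y\}$ and $s^+(t)=\inf\{y: a(x,t)=0\text{ for all }x>y\}$. $\|\cdot\|_\infty$ denotes the essential supremum with respect to the space variable $x$.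
   Formalization: The middle inequality s_j^-(t) ≤ s_j^+(t) is asserted only at times t when u_j(·,t) is not identically zero; otherwise (e.g. u_0 = 0) the definitions give s_j^- = +∞ and s_j^+ = −∞, so it fails. *)

theory Defs
  imports "HOL-Analysis.Analysis" "HOL-Probability.Essential_Supremum"
begin

definition Linf_norm :: "(real \<Rightarrow> real ^ 'n) \<Rightarrow> ereal" where
  "Linf_norm f = esssup lebesgue (\<lambda>x. ereal (norm (f x)))"

definition initial_potential :: "real ^ 'n \<Rightarrow> (real \<Rightarrow> real ^ 'n) \<Rightarrow> real \<Rightarrow> real" where
  "initial_potential c u0 y =
     interval_lebesgue_integral lebesgue 0 (ereal y) (\<lambda>z. \<Sum>k\<in>UNIV. c $ k * u0 z $ k)"

definition viscous_weight ::
    "real ^ 'n \<Rightarrow> (real \<Rightarrow> real ^ 'n) \<Rightarrow> real \<Rightarrow> real \<Rightarrow> real \<Rightarrow> real \<Rightarrow> real" where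
  "viscous_weight c u0 \<nu> x t y =
     exp (- (1 / \<nu>) * (initial_potential c u0 y + (x - y)\<^sup>2 / (2 * t)))"

text \<open>The Hopf--Cole representation of the solution of
  \<open>(u\<^sub>j)\<^sub>t + \<sigma>(c,u) (u\<^sub>j)\<^sub>x = (\<nu>/2) (u\<^sub>j)\<^sub>x\<^sub>x\<close>,
  \<open>\<sigma>(c,u) = \<Sum>\<^sub>k c\<^sub>k u\<^sub>k\<close>, with initial data \<open>u0\<close>.\<close>

definition viscous_solution ::
    "real ^ 'n \<Rightarrow> (real \<Rightarrow> real ^ 'n) \<Rightarrow> real \<Rightarrow> real \<Rightarrow> real \<Rightarrow> real ^ 'n" where
  "viscous_solution c u0 \<nu> x t =
     (\<chi> j. (\<integral>y. u0 y $ j * viscous_weight c u0 \<nu> x t y \<partial>lebesgue) /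
           (\<integral>y. viscous_weight c u0 \<nu> x t y \<partial>lebesgue))"

text \<open>The limit \<open>\<nu> \<rightarrow> 0\<close> need not exist at every \<open>x\<close>, e.g. on shocks.  It is
  required to exist for every \<open>t > 0\<close> and almost every \<open>x\<close>; \<open>u\<close> equals the limit at
  \<^emph>\<open>every\<close> point where it exists and is unconstrained at the remaining points.
  (Prescribing \<open>u\<close> only almost everywhere would not do, because the boundary curves
  below depend on pointwise values.)\<close>

definition vanishing_viscosity_solution ::
    "real ^ 'n \<Rightarrow> (real \<Rightarrow> real ^ 'n) \<Rightarrow> (real \<Rightarrow> real \<Rightarrow> real ^ 'n) \<Rightarrow> bool" where
  "vanishing_viscosity_solution c u0 u \<longleftrightarrow>
     (\<forall>x. u x 0 = u0 x) \<and>
     (\<forall>t>0. \<forall>j.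
        (AE x in lebesgue. \<exists>L. ((\<lambda>\<nu>. viscous_solution c u0 \<nu> x t $ j) \<longlongrightarrow> L) (at_right 0)) \<and>
        (\<forall>x L. ((\<lambda>\<nu>. viscous_solution c u0 \<nu> x t $ j) \<longlongrightarrow> L) (at_right 0) \<longrightarrow> u x t $ j = L))"

text \<open>The boundary curves are extended-real valued, so that \<open>Sup\<close> and \<open>Inf\<close> are meaningful
  without side conditions.  If \<open>a(\<sqdot>,t)\<close> vanishes identically, the left boundary is \<open>\<infinity>\<close> and
  the right boundary is \<open>-\<infinity>\<close>.\<close>

definition left_boundary :: "(real \<Rightarrow> real \<Rightarrow> real) \<Rightarrow> real \<Rightarrow> ereal" where
  "left_boundary a t = Sup {ereal y | y. \<forall>x<y. a x t = 0}"

definition right_boundary :: "(real \<Rightarrow> real \<Rightarrow> real) \<Rightarrow> real \<Rightarrow> ereal" where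
  "right_boundary a t = Inf {ereal y | y. \<forall>x>y. a x t = 0}"

end

theory Submission
  imports Defs
begin

text \<open>
  The potential \<open>I\<close> is bounded by a constant \<open>B\<close> depending only on \<open>l\<close>, \<open>c\<close> and
  \<open>\<parallel>u\<^sub>0\<parallel>\<^sub>\<infinity>\<close>, because its integrand is bounded and lives on \<open>[-l, l]\<close>. The parabola
  \<open>(x - y)\<^sup>2 / (2 t)\<close>, on the other hand, exceeds \<open>A\<^sup>2 / 2\<close> for all \<open>y\<close> in \<open>[-l, l]\<close> as soon as
  \<open>\<bar>x\<bar> > l + A \<surd>t\<close>. If \<open>A\<^sup>2 / 2\<close> is larger than the oscillation \<open>2 B\<close> of the potential by a
  fixed margin, the phase \<open>I y + (x - y)\<^sup>2 / (2 t)\<close> is larger on the support of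
  \<open>u\<^sub>0\<close> than near \<open>y = x\<close>. In the Hopf--Cole quotient the numerator sees only
  the support of \<open>u\<^sub>0\<close>, whereas the denominator is at least the contribution from near \<open>x\<close>;
  the quotient is therefore \<open>O(exp (- 1 / \<nu>))\<close> and tends to \<open>0\<close>
  (lemma \<open>viscous_solution_tendsto_0_far\<close>). So the vanishing viscosity solution is zero at
  every such point \<open>x\<close>, which confines its support to \<open>[-l - A \<surd>t, l + A \<surd>t]\<close>.
\<close>

lemma abs_integral_le_integral_AE:
  fixes f g :: "'a \<Rightarrow> real"
  assumes "integrable M g" and "AE x in M. \<bar>f x\<bar> \<le> g x"
  shows "\<bar>integral\<^sup>L M f\<bar> \<le> integral\<^sup>L M g"
proof (cases "integrable M f")
  case True
  have "\<bar>integral\<^sup>L M f\<bar> \<le> (\<integral>x. \<bar>f x\<bar> \<partial>M)"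
    by (rule integral_abs_bound)
  also have "\<dots> \<le> integral\<^sup>L M g"
    using assms True by (intro integral_mono_AE) auto
  finally show ?thesis .
next
  case False
  have "0 \<le> integral\<^sup>L M g"
    using assms(2) by (intro integral_nonneg_AE) (auto elim: eventually_mono)
  then show ?thesis
    using False by (simp add: not_integrable_integral_eq)
qed

lemma integrable_lebesgue_const_indicator_interval:
  "integrable lebesgue (\<lambda>y. C * indicator {a..b::real} y :: real)"
proof -
  have "{a..b} \<in> lmeasurable"
    using lmeasurable_cbox[of a b] by simp
  then show ?thesis
    by (intro integrable_mult_right) (simp add: lmeasurable_iff_integrable)
qed

lemma abs_integral_le_of_bounded_support:
  fixes f :: "real \<Rightarrow> real"
  assumes "l > 0" and "AE y in lebesgue. \<bar>f y\<bar> \<le> M * indicator {-l..l} y"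
  shows "\<bar>integral\<^sup>L lebesgue f\<bar> \<le> 2 * l * M"
proof -
  have "\<bar>integral\<^sup>L lebesgue f\<bar> \<le> (\<integral>y. M * indicator {-l..l} y \<partial>lebesgue)"
    using integrable_lebesgue_const_indicator_interval assms(2)
    by (rule abs_integral_le_integral_AE)
  also have "\<dots> = 2 * l * M"
    using \<open>l > 0\<close> by simp
  finally show ?thesis .
qed

lemma AE_norm_le_Linf_norm:
  fixes u0 :: "real \<Rightarrow> real ^ 'n"
  assumes "Linf_norm u0 = ereal K"
  shows "AE y in lebesgue. norm (u0 y) \<le> K"
  using esssup_AE[of "\<lambda>x. ereal (norm (u0 x))" lebesgue] assms
  by (simp add: Linf_norm_def)

lemma abs_initial_potential_le:
  fixes c :: "real ^ 'n"
  assumes "l > 0"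
    and bound: "AE y in lebesgue. norm (u0 y) \<le> K"
    and supp: "\<And>x. x \<notin> {-l..l} \<Longrightarrow> u0 x = 0"
  shows "\<bar>initial_potential c u0 y\<bar> \<le> 2 * l * (norm c * K)"
proof -
  have speed: "(\<Sum>k\<in>UNIV. c $ k * u0 z $ k) = c \<bullet> u0 z" for z
    by (simp add: inner_vec_def)
  have "\<bar>\<integral>z. indicator S z *\<^sub>R (\<Sum>k\<in>UNIV. c $ k * u0 z $ k) \<partial>lebesgue\<bar> \<le> 2 * l * (norm c * K)"
    for S :: "real set"
  proof (rule abs_integral_le_of_bounded_support[OF \<open>l > 0\<close>])
    show "AE z in lebesgue. \<bar>indicator S z *\<^sub>R (\<Sum>k\<in>UNIV. c $ k * u0 z $ k)\<bar>
            \<le> norm c * K * indicator {-l..l} z"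
      using bound
    proof eventually_elim
      case (elim z)
      have "\<bar>c \<bullet> u0 z\<bar> \<le> norm c * norm (u0 z)"
        by (rule Cauchy_Schwarz_ineq2)
      also have "\<dots> \<le> norm c * K"
        using elim by (intro mult_left_mono) auto
      finally have "\<bar>c \<bullet> u0 z\<bar> \<le> norm c * K" .
      moreover have "0 \<le> norm c * K"
        using order_trans[OF norm_ge_zero elim] by (intro mult_nonneg_nonneg norm_ge_zero)
      ultimately show ?case
        using supp[of z] unfolding speed by (auto simp: indicator_def)
    qed
  qed
  then show ?thesis
    by (simp add: initial_potential_def interval_lebesgue_integral_def
        set_lebesgue_integral_def)
qed

text \<open>The contribution of the interval \<open>[x - \<surd>t, x + \<surd>t]\<close> alone; its width is chosen so that
  the parabola \<open>(x - y)\<^sup>2 / (2 t)\<close> stays below \<open>1\<close> there.\<close>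

lemma integral_viscous_weight_ge:
  fixes c :: "real ^ 'n"
  assumes "\<nu> > 0" and "t > 0"
    and pot: "\<And>y. initial_potential c u0 y \<le> B"
    and int: "integrable lebesgue (viscous_weight c u0 \<nu> x t)"
  shows "2 * sqrt t * exp (- (1 / \<nu>) * (B + 1)) \<le> (\<integral>y. viscous_weight c u0 \<nu> x t y \<partial>lebesgue)"
proof -
  let ?J = "{x - sqrt t..x + sqrt t}"
  let ?e = "exp (- (1 / \<nu>) * (B + 1))"
  have "2 * sqrt t * ?e = (\<integral>y. ?e * indicator ?J y \<partial>lebesgue)"
    using \<open>t > 0\<close> by simp
  also have "\<dots> \<le> (\<integral>y. viscous_weight c u0 \<nu> x t y \<partial>lebesgue)"
  proof (rule integral_mono[OF _ int])
    show "integrable lebesgue (\<lambda>y. ?e * indicator ?J y :: real)"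
      by (rule integrable_lebesgue_const_indicator_interval)
  next
    fix y
    show "?e * indicator ?J y \<le> viscous_weight c u0 \<nu> x t y"
    proof (cases "y \<in> ?J")
      case True
      then have "\<bar>x - y\<bar> \<le> sqrt t"
        by auto
      then have "(x - y)\<^sup>2 \<le> t"
        using \<open>t > 0\<close> by (metis abs_ge_zero power2_abs power_mono real_sqrt_pow2 less_imp_le)
      then have "(x - y)\<^sup>2 / (2 * t) \<le> 1"
        using \<open>t > 0\<close> by (simp add: divide_simps)
      then have "initial_potential c u0 y + (x - y)\<^sup>2 / (2 * t) \<le> B + 1"
        using pot[of y] by linarith
      then have "?e \<le> viscous_weight c u0 \<nu> x t y"
        unfolding viscous_weight_def exp_le_cancel_iff
        using \<open>\<nu> > 0\<close> by (intro mult_left_mono_neg) auto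
      then show ?thesis
        using True by simp
    next
      case False
      then show ?thesis
        by (simp add: viscous_weight_def)
    qed
  qed
  finally show ?thesis .
qed

text \<open>The constant \<open>A\<^sup>2 = 4 B + 4\<close> makes the phase at least \<open>A\<^sup>2 / 2 - B = B + 2\<close> on the support
  of the data. This beats the value \<open>B + 1\<close> available near \<open>x\<close> by one unit, which
  produces the factor \<open>exp (- 1 / \<nu>)\<close>.\<close>

lemma abs_viscous_solution_le_far:
  fixes c :: "real ^ 'n"
  assumes "l > 0" and "\<nu> > 0" and "t > 0"
    and bound: "AE y in lebesgue. norm (u0 y) \<le> K"
    and supp: "\<And>x. x \<notin> {-l..l} \<Longrightarrow> u0 x = 0"
    and pot: "\<And>y. \<bar>initial_potential c u0 y\<bar> \<le> B"
    and far: "\<bar>x\<bar> > l + sqrt (4 * B + 4) * sqrt t"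
  shows "\<bar>viscous_solution c u0 \<nu> x t $ j\<bar> \<le> l * \<bar>K\<bar> / sqrt t * exp (- (1 / \<nu>))"
proof -
  let ?w = "viscous_weight c u0 \<nu> x t"
  let ?N = "\<integral>y. u0 y $ j * ?w y \<partial>lebesgue"
  let ?D = "\<integral>y. ?w y \<partial>lebesgue"
  have "B \<ge> 0"
    using pot[of 0] by linarith
  have w_le: "?w y \<le> exp (- (1 / \<nu>) * (B + 2))" if "y \<in> {-l..l}" for y
  proof -
    have "sqrt (4 * B + 4) * sqrt t \<le> \<bar>x - y\<bar>"
      using far that by auto
    then have "(sqrt (4 * B + 4) * sqrt t)\<^sup>2 \<le> \<bar>x - y\<bar>\<^sup>2"
      using \<open>B \<ge> 0\<close> \<open>t > 0\<close> by (intro power_mono) auto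
    then have "(4 * B + 4) * t \<le> (x - y)\<^sup>2"
      using \<open>B \<ge> 0\<close> \<open>t > 0\<close> by (simp add: power_mult_distrib)
    then have "2 * B + 2 \<le> (x - y)\<^sup>2 / (2 * t)"
      using \<open>t > 0\<close> by (simp add: field_simps)
    then have "B + 2 \<le> initial_potential c u0 y + (x - y)\<^sup>2 / (2 * t)"
      using pot[of y] by linarith
    then show ?thesis
      unfolding viscous_weight_def exp_le_cancel_iff
      using \<open>\<nu> > 0\<close> by (intro mult_left_mono_neg) auto
  qed
  have N: "\<bar>?N\<bar> \<le> 2 * l * (\<bar>K\<bar> * exp (- (1 / \<nu>) * (B + 2)))"
  proof (rule abs_integral_le_of_bounded_support[OF \<open>l > 0\<close>])
    show "AE y in lebesgue. \<bar>u0 y $ j * ?w y\<bar>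
            \<le> \<bar>K\<bar> * exp (- (1 / \<nu>) * (B + 2)) * indicator {-l..l} y"
      using bound
    proof eventually_elim
      case (elim y)
      show ?case
      proof (cases "y \<in> {-l..l}")
        case True
        have "\<bar>u0 y $ j\<bar> \<le> \<bar>K\<bar>"
          using component_le_norm_cart[of "u0 y" j] elim by linarith
        then have "\<bar>u0 y $ j\<bar> * ?w y \<le> \<bar>K\<bar> * exp (- (1 / \<nu>) * (B + 2))"
          using w_le[OF True] by (intro mult_mono) (auto simp: viscous_weight_def)
        then show ?thesis
          using True by (simp add: abs_mult viscous_weight_def)
      next
        case False
        then show ?thesis
          using supp[OF False] by simp
      qed
    qed
  qed
  show ?thesis
  proof (cases "integrable lebesgue ?w")
    case True
    have D: "2 * sqrt t * exp (- (1 / \<nu>) * (B + 1)) \<le> ?D"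
      using pot True \<open>\<nu> > 0\<close> \<open>t > 0\<close>
      by (intro integral_viscous_weight_ge) (auto intro: order_trans[OF abs_ge_self])
    have "?D > 0"
      using D \<open>t > 0\<close> by (intro less_le_trans[OF _ D]) auto
    have "exp (- (1 / \<nu>) * (B + 2)) = exp (- (1 / \<nu>)) * exp (- (1 / \<nu>) * (B + 1))"
      by (simp add: exp_add[symmetric] algebra_simps flip: add_divide_distrib)
    then have "\<bar>?N\<bar> \<le> l * \<bar>K\<bar> / sqrt t * exp (- (1 / \<nu>)) * (2 * sqrt t * exp (- (1 / \<nu>) * (B + 1)))"
      using N \<open>t > 0\<close> by (simp add: mult_ac)
    also have "\<dots> \<le> l * \<bar>K\<bar> / sqrt t * exp (- (1 / \<nu>)) * ?D"
      using D \<open>l > 0\<close> \<open>t > 0\<close> by (intro mult_left_mono) auto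
    finally show ?thesis
      using \<open>?D > 0\<close> by (simp add: viscous_solution_def pos_divide_le_eq)
  next
    \<comment> \<open>The integral of a non-integrable function is \<open>0\<close>, and so is a quotient by \<open>0\<close>.\<close>
    case False
    then show ?thesis
      using \<open>l > 0\<close> \<open>t > 0\<close>
      by (simp add: viscous_solution_def not_integrable_integral_eq)
  qed
qed

lemma viscous_solution_tendsto_0_far:
  fixes c :: "real ^ 'n"
  assumes "l > 0" and "t > 0"
    and "AE y in lebesgue. norm (u0 y) \<le> K"
    and "\<And>x. x \<notin> {-l..l} \<Longrightarrow> u0 x = 0"
    and "\<And>y. \<bar>initial_potential c u0 y\<bar> \<le> B"
    and "\<bar>x\<bar> > l + sqrt (4 * B + 4) * sqrt t"
  shows "((\<lambda>\<nu>. viscous_solution c u0 \<nu> x t $ j) \<longlongrightarrow> 0) (at_right 0)"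
proof (rule Lim_null_comparison)
  show "\<forall>\<^sub>F \<nu> in at_right 0. norm (viscous_solution c u0 \<nu> x t $ j)
          \<le> l * \<bar>K\<bar> / sqrt t * exp (- (1 / \<nu>))"
    using eventually_at_right_less[of "0::real"]
    by eventually_elim (use abs_viscous_solution_le_far[OF assms(1) _ assms(2-)] in auto)
  have "((\<lambda>\<nu>::real. exp (- (1 / \<nu>))) \<longlongrightarrow> 0) (at_right 0)"
    using filterlim_inverse_at_top_right
    by (intro filterlim_compose[OF exp_at_bot] filterlim_compose[OF filterlim_uminus_at_bot_at_top])
      (simp add: inverse_eq_divide)
  then show "((\<lambda>\<nu>. l * \<bar>K\<bar> / sqrt t * exp (- (1 / \<nu>))) \<longlongrightarrow> 0) (at_right 0)"
    by (rule tendsto_mult_right_zero)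
qed

lemma le_left_boundary:
  assumes "\<And>x. x < y \<Longrightarrow> a x t = 0"
  shows "ereal y \<le> left_boundary a t"
  unfolding left_boundary_def using assms by (intro Sup_upper) auto

lemma right_boundary_le:
  assumes "\<And>x. x > y \<Longrightarrow> a x t = 0"
  shows "right_boundary a t \<le> ereal y"
  unfolding right_boundary_def using assms by (intro Inf_lower) auto

lemma left_boundary_le_right_boundary:
  assumes "a x t \<noteq> 0"
  shows "left_boundary a t \<le> right_boundary a t"
proof -
  have "left_boundary a t \<le> ereal x"
    unfolding left_boundary_def using assms by (intro Sup_least) (auto simp: not_less[symmetric])
  also have "ereal x \<le> right_boundary a t"
    unfolding right_boundary_def using assms by (intro Inf_greatest) (auto simp: not_less[symmetric])
  finally show ?thesis .
qed

theorem theorem3p1: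
  fixes c :: "real ^ 'n" and l K :: real
  assumes "l > 0"
  shows "\<exists>A>0. \<exists>T>0. \<forall>(u0 :: real \<Rightarrow> real ^ 'n) u.
           u0 \<in> borel_measurable lebesgue \<longrightarrow>
           Linf_norm u0 = ereal K \<longrightarrow>
           (\<forall>x. x \<notin> {-l..l} \<longrightarrow> u0 x = 0) \<longrightarrow>
           vanishing_viscosity_solution c u0 u \<longrightarrow>
           (\<forall>t\<ge>T. \<forall>j.
              ereal (- l - A * sqrt t) \<le> left_boundary (\<lambda>x t. u x t $ j) t \<and>
              ((\<exists>x. u x t $ j \<noteq> 0) \<longrightarrow>
                 left_boundary (\<lambda>x t. u x t $ j) t \<le> right_boundary (\<lambda>x t. u x t $ j) t) \<and>
              right_boundary (\<lambda>x t. u x t $ j) t \<le> ereal (l + A * sqrt t))"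
proof -
  \<comment> \<open>\<open>A\<close> is chosen before \<open>u\<^sub>0\<close>, when \<open>K\<close> is not yet known to be a norm; hence \<open>\<bar>K\<bar>\<close>.\<close>
  define B where "B = 2 * l * (norm c * \<bar>K\<bar>)"
  define A where "A = sqrt (4 * B + 4)"
  have "B \<ge> 0"
    using \<open>l > 0\<close> by (simp add: B_def)
  then have "A > 0"
    by (simp add: A_def)
  have main: "ereal (- l - A * sqrt t) \<le> left_boundary (\<lambda>x t. u x t $ j) t \<and>
              ((\<exists>x. u x t $ j \<noteq> 0) \<longrightarrow>
                 left_boundary (\<lambda>x t. u x t $ j) t \<le> right_boundary (\<lambda>x t. u x t $ j) t) \<and>
              right_boundary (\<lambda>x t. u x t $ j) t \<le> ereal (l + A * sqrt t)"
    if K: "Linf_norm u0 = ereal K" and supp: "\<forall>x. x \<notin> {-l..l} \<longrightarrow> u0 x = 0"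
      and vv: "vanishing_viscosity_solution c u0 u" and "t \<ge> 1"
    for u0 :: "real \<Rightarrow> real ^ 'n" and u t j
  proof -
    have "t > 0"
      using \<open>t \<ge> 1\<close> by simp
    have bound: "AE y in lebesgue. norm (u0 y) \<le> \<bar>K\<bar>"
      using AE_norm_le_Linf_norm[OF K] by eventually_elim simp
    have "\<bar>initial_potential c u0 y\<bar> \<le> B" for y
      unfolding B_def using \<open>l > 0\<close> bound supp by (intro abs_initial_potential_le) auto
    then have zero: "u x t $ j = 0" if "\<bar>x\<bar> > l + A * sqrt t" for x
      using viscous_solution_tendsto_0_far[OF \<open>l > 0\<close> \<open>t > 0\<close> bound, of c B x j]
        supp that vv \<open>t > 0\<close>
      unfolding A_def vanishing_viscosity_solution_def by blast
    show ?thesis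
    proof (intro conjI impI)
      show "ereal (- l - A * sqrt t) \<le> left_boundary (\<lambda>x t. u x t $ j) t"
        by (intro le_left_boundary zero) auto
      show "right_boundary (\<lambda>x t. u x t $ j) t \<le> ereal (l + A * sqrt t)"
        by (intro right_boundary_le zero) auto
      show "left_boundary (\<lambda>x t. u x t $ j) t \<le> right_boundary (\<lambda>x t. u x t $ j) t"
        if "\<exists>x. u x t $ j \<noteq> 0"
        using that left_boundary_le_right_boundary[of "\<lambda>x t. u x t $ j"] by auto
    qed
  qed
  show ?thesis
    by (rule exI[of _ A], intro conjI \<open>A > 0\<close>, rule exI[of _ 1]) (use main in auto)
qed

end
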